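(* Let $X$ be a compact Hausdorff space with a probability Borel measure $\mu$, let $\psi:X\to\mathbb R$ be a non-negative continuous function with $\mu\{x;\psi(x)=r\}=0$ for every $r\in\mathbb R$, let $0<\lambda_1<\cdots<\lambda_N$ be constants, and let $\psi_i=\lambda_i\psi$ for $i\in I=\{1,\ldots,N\}$. Then for any capacity vector $\vec M=(M_1,\ldots,M_N)\in\mathbb R^N_+$ with $\sum_{i=1}^NM_i=\mu(X)$, the corresponding coalition/partition game $\nu:2^I\to\mathbb R_+$ is super-additive, i.e. $$\nu(J_1)+\nu(J_2)\le\nu(J_1\cup J_2)\qquad\text{for all }J_1,J_2\subseteq I\text{ with }J_1\cap J_2=\emptyset .$$
   Context: Capacities satisfy $M_i>0$. For $J\subseteq I$ let $J^-=I\setminus J$, $M_J=\sum_{i\in J}M_i$, $\psi_J(x)=\max_{i\in J}\psi_i(x)$. Coalition/partition (CP) game $\nu$: for $\emptyset\ne J\subsetneq I$, consider pairs $(A_J,A_{J^-})$ of measurable subsets of $X$ with $\mu(A_J)\le M_J$, $\mu(A_{J^-})\le M_{J^-}$, $\mu(A_J\cap A_{J^-})=0$. There is a unique (up to $\mu$-null sets) such pair $(\bar A_J,\bar A_{J^-})$ maximizing $\int_{A_J}\psi_J\,d\mu+\int_{A_{J^-}}\psi_{J^-}\,d\mu$, and $\nu(J):=\int_{\bar A_J}\psi_J\,d\mu$. Moreover $\nu(I):=\int_X\psi_I\,d\mu$ and $\nu(\emptyset):=0$. *)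

theory Defs
  imports "HOL-Probability.Probability"
begin

text \<open>
  Agents form a finite set \<open>I\<close> of natural numbers; agent \<open>i\<close> has the utility \<open>\<psi> i\<close> and the
  capacity \<open>M i\<close>. For \<open>J \<subseteq> I\<close> the complementary coalition is \<open>I - J\<close> and its capacity is \<open>sum M (I - J)\<close>.
\<close>

text \<open>Meaningful for nonempty finite \<open>J\<close> only.\<close>

definition coalition_utility :: "(nat \<Rightarrow> 'a \<Rightarrow> real) \<Rightarrow> nat set \<Rightarrow> 'a \<Rightarrow> real" where
  "coalition_utility \<psi> J x = Max ((\<lambda>i. \<psi> i x) ` J)"

definition cp_feasible ::
  "'a measure \<Rightarrow> nat set \<Rightarrow> (nat \<Rightarrow> real) \<Rightarrow> nat set \<Rightarrow> 'a set \<Rightarrow> 'a set \<Rightarrow> bool" where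
  "cp_feasible \<mu> I M J A B \<longleftrightarrow>
     A \<in> sets \<mu> \<and> B \<in> sets \<mu> \<and>
     measure \<mu> A \<le> sum M J \<and> measure \<mu> B \<le> sum M (I - J) \<and>
     measure \<mu> (A \<inter> B) = 0"

definition cp_profit ::
  "'a measure \<Rightarrow> nat set \<Rightarrow> (nat \<Rightarrow> 'a \<Rightarrow> real) \<Rightarrow> nat set \<Rightarrow> 'a set \<Rightarrow> 'a set \<Rightarrow> real" where
  "cp_profit \<mu> I \<psi> J A B =
     (LINT x:A|\<mu>. coalition_utility \<psi> J x) + (LINT x:B|\<mu>. coalition_utility \<psi> (I - J) x)"

definition cp_maximizer ::
  "'a measure \<Rightarrow> nat set \<Rightarrow> (nat \<Rightarrow> 'a \<Rightarrow> real) \<Rightarrow> (nat \<Rightarrow> real) \<Rightarrow> nat set \<Rightarrow> 'a set \<Rightarrow> 'a set \<Rightarrow> bool"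
where
  "cp_maximizer \<mu> I \<psi> M J A B \<longleftrightarrow>
     cp_feasible \<mu> I M J A B \<and>
     (\<forall>A' B'. cp_feasible \<mu> I M J A' B' \<longrightarrow> cp_profit \<mu> I \<psi> J A' B' \<le> cp_profit \<mu> I \<psi> J A B)"

text \<open>
  The maximizing pair is unique only up to null sets, so the definite description ranges over the
  value of the integral, which is the same for all maximizing pairs, and not over the pair itself.
\<close>

definition cp_game ::
  "'a measure \<Rightarrow> nat set \<Rightarrow> (nat \<Rightarrow> 'a \<Rightarrow> real) \<Rightarrow> (nat \<Rightarrow> real) \<Rightarrow> nat set \<Rightarrow> real" where
  "cp_game \<mu> I \<psi> M J =
     (if J = {} then 0
      else if J = I then LINT x|\<mu>. coalition_utility \<psi> I x
      else THE v. \<exists>A B. cp_maximizer \<mu> I \<psi> M J A B \<and> v = (LINT x:A|\<mu>. coalition_utility \<psi> J x))"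

definition superadditive_game :: "nat set \<Rightarrow> (nat set \<Rightarrow> real) \<Rightarrow> bool" where
  "superadditive_game I \<nu> \<longleftrightarrow>
     (\<forall>J1 J2. J1 \<subseteq> I \<longrightarrow> J2 \<subseteq> I \<longrightarrow> J1 \<inter> J2 = {} \<longrightarrow> \<nu> J1 + \<nu> J2 \<le> \<nu> (J1 \<union> J2))"

end

theory Submission
  imports Defs
begin

text \<open>
  Write \<open>m\<^sub>J = sum M J\<close> and \<open>\<lambda>\<^sub>J\<close> for the maximum of \<open>lam\<close> on \<open>J\<close>. The profit of a feasible pair
  is governed by the coalition with the larger factor, and rearranging
  \<open>a \<integral>\<^sub>A \<psi> + b \<integral>\<^sub>B \<psi> = a \<integral>\<^sub>A\<^sub>\<union>\<^sub>B \<psi> + (b - a) \<integral>\<^sub>B \<psi>\<close> shows that this coalition takes the superlevel set of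
  \<open>\<psi>\<close> of the measure it can afford, while the other one gets the remaining sublevel set. Hence
  \<open>\<nu> J\<close> is \<open>\<lambda>\<^sub>J\<close> times the integral of \<open>\<psi>\<close> over the top part of mass \<open>m\<^sub>J\<close> if \<open>N \<in> J\<close>, and over the
  bottom part of mass \<open>m\<^sub>J\<close> otherwise. Superadditivity follows because the bottom integral is
  superadditive in the mass, and because a top part and a disjoint bottom part together carry at
  most the integral over the top part of the joint mass.
\<close>

lemma cp_game_empty [simp]: "cp_game \<mu> I \<psi> M {} = 0"
  by (simp add: cp_game_def)

section \<open>Masses of measurable sets under an atomless utility\<close>

text \<open>Compactness and continuity are condensed into integrability of \<open>\<psi>\<close>, so
  everything up to the final theorem is pure measure theory.\<close>

locale atomless_utility = prob_space \<mu> for \<mu> :: "'a measure" +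
  fixes \<psi> :: "'a \<Rightarrow> real"
  assumes integrable_utility: "integrable \<mu> \<psi>"
    and utility_nonneg: "0 \<le> \<psi> x"
    and utility_atomless: "prob {x \<in> space \<mu>. \<psi> x = r} = 0"
begin

abbreviation upper :: "real \<Rightarrow> 'a set" where
  "upper t \<equiv> {x \<in> space \<mu>. t < \<psi> x}"

abbreviation lower :: "real \<Rightarrow> 'a set" where
  "lower t \<equiv> {x \<in> space \<mu>. \<psi> x \<le> t}"

abbreviation mass :: "'a set \<Rightarrow> real" where
  "mass A \<equiv> LINT x:A|\<mu>. \<psi> x"

lemma measurable_utility [measurable]: "\<psi> \<in> borel_measurable \<mu>"
  using integrable_utility by (rule borel_measurable_integrable)

lemma set_integrable_utility: "A \<in> sets \<mu> \<Longrightarrow> set_integrable \<mu> A \<psi>"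
  unfolding set_integrable_def using integrable_utility
  by (rule integrable_mult_indicator[rotated])

lemma mass_mono:
  assumes "A \<in> sets \<mu>" "B \<in> sets \<mu>" "A \<subseteq> B"
  shows "mass A \<le> mass B"
  unfolding set_lebesgue_integral_def
  using set_integrable_utility assms utility_nonneg
  by (intro integral_mono) (auto simp: set_integrable_def indicator_def)

lemma mass_nonneg: "0 \<le> mass A"
  unfolding set_lebesgue_integral_def using utility_nonneg by simp

lemma mass_space: "mass (space \<mu>) = (LINT x|\<mu>. \<psi> x)"
  unfolding set_lebesgue_integral_def by (intro Bochner_Integration.integral_cong) auto

lemma mass_Un:
  assumes "A \<in> sets \<mu>" "B \<in> sets \<mu>" "prob (A \<inter> B) = 0"
  shows "mass (A \<union> B) = mass A + mass B"
proof (rule set_integral_Un_AE)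
  have "A \<inter> B \<in> null_sets \<mu>"
    using assms by (auto simp: null_sets_def emeasure_eq_measure)
  from AE_not_in[OF this] show "AE x in \<mu>. \<not> (x \<in> A \<and> x \<in> B)"
    by simp
qed (use assms set_integrable_utility in auto)

lemma mass_Compl:
  assumes "A \<in> sets \<mu>"
  shows "mass (space \<mu> - A) = mass (space \<mu>) - mass A"
proof -
  have "mass (A \<union> (space \<mu> - A)) = mass A + mass (space \<mu> - A)"
    using assms by (intro mass_Un) auto
  moreover have "A \<union> (space \<mu> - A) = space \<mu>"
    using sets.sets_into_space[OF assms] by auto
  ultimately show ?thesis by simp
qed

lemma Compl_upper: "space \<mu> - upper t = lower t"
  by auto

lemma prob_lower: "prob (lower t) = 1 - prob (upper t)"
  using prob_compl[of "upper t"] by (simp add: Compl_upper)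

lemma mass_lower: "mass (lower t) = mass (space \<mu>) - mass (upper t)"
  using mass_Compl[of "upper t"] by (simp add: Compl_upper)

lemma prob_lower_0: "prob (lower 0) = 0"
proof -
  have "lower 0 = {x \<in> space \<mu>. \<psi> x = 0}"
    using utility_nonneg by (auto intro: antisym)
  then show ?thesis by (simp add: utility_atomless)
qed

text \<open>The distribution function of \<open>\<psi>\<close> is continuous because no level has
  positive probability, it vanishes at 0 and tends to 1; the intermediate value theorem applies. The
  bound \<open>m < 1\<close> is strict because an unbounded \<open>\<psi>\<close> need not reach the
  value 1 at a finite level.\<close>

lemma ex_lower_prob:
  assumes "0 \<le> m" "m < 1"
  obtains t where "0 \<le> t" "prob (lower t) = m"
proof -
  interpret D: real_distribution "distr \<mu> borel \<psi>"
    by (rule real_distribution_distr) measurable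
  have "cdf (distr \<mu> borel \<psi>) t = prob (lower t)" for t
    by (auto simp: cdf_def measure_distr intro!: arg_cong[where f = prob])
  then have cdf: "cdf (distr \<mu> borel \<psi>) = (\<lambda>t. prob (lower t))"
    by (rule ext)
  have "measure (distr \<mu> borel \<psi>) {t} = prob {x \<in> space \<mu>. \<psi> x = t}" for t
    by (auto simp: measure_distr intro!: arg_cong[where f = prob])
  then have cont: "isCont (cdf (distr \<mu> borel \<psi>)) t" for t
    by (simp add: D.isCont_cdf utility_atomless)
  have "\<forall>\<^sub>F t in at_top. m < cdf (distr \<mu> borel \<psi>) t"
    using D.cdf_lim_at_top_prob assms(2) by (rule order_tendstoD)
  then obtain u where "0 \<le> u" "m < cdf (distr \<mu> borel \<psi>) u"
    unfolding eventually_at_top_linorder by (metis linorder_le_cases)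
  then have "\<exists>t. 0 \<le> t \<and> t \<le> u \<and> cdf (distr \<mu> borel \<psi>) t = m"
    using assms(1) cont by (intro IVT) (simp_all add: cdf prob_lower_0)
  then show ?thesis using that by (auto simp: cdf)
qed

section \<open>Extremality of level sets\<close>

text \<open>Bathtub principle: \<open>\<psi> - t\<close> is positive on \<open>upper t\<close> and
  at most 0 off it, so the difference of the two indicators times \<open>\<psi> - t\<close> is
  nowhere positive. Integrating bounds the mass difference by \<open>t\<close> times the difference
  of probabilities, and \<open>0 \<le> t\<close> fixes the sign.\<close>

lemma mass_le_upper:
  assumes "0 \<le> t" "A \<in> sets \<mu>" "prob A \<le> prob (upper t)"
  shows "mass A \<le> mass (upper t)"
proof -
  have int: "integrable \<mu> (\<lambda>x. indicat_real B x * \<psi> x)" if "B \<in> sets \<mu>" for B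
    using set_integrable_utility[OF that] by (simp add: set_integrable_def)
  have "mass A - mass (upper t)
      = (\<integral>x. indicat_real A x * \<psi> x - indicat_real (upper t) x * \<psi> x \<partial>\<mu>)"
    using int[OF assms(2)] int[of "upper t"] by (simp add: set_lebesgue_integral_def)
  also have "\<dots> \<le> (\<integral>x. t * (indicat_real A x - indicat_real (upper t) x) \<partial>\<mu>)"
  proof (rule integral_mono)
    show "integrable \<mu> (\<lambda>x. indicat_real A x * \<psi> x - indicat_real (upper t) x * \<psi> x)"
      using assms(2) by (intro Bochner_Integration.integrable_diff int) auto
    show "integrable \<mu> (\<lambda>x. t * (indicat_real A x - indicat_real (upper t) x))"
      using assms(2)
      by (intro integrable_mult_right Bochner_Integration.integrable_diff integrable_real_indicator)
        (auto simp: emeasure_eq_measure)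
  qed (auto simp: indicator_def)
  also have "\<dots> = t * (prob A - prob (upper t))"
    using assms(2) by (simp add: emeasure_eq_measure)
  also have "\<dots> \<le> 0"
    using assms(1,3) by (simp add: mult_nonneg_nonpos)
  finally show ?thesis by simp
qed

text \<open>The bathtub principle for the complement of \<open>A\<close>, which is no more probable
  than \<open>upper t\<close>.\<close>

lemma mass_ge_lower:
  assumes "0 \<le> t" "A \<in> sets \<mu>" "prob (lower t) \<le> prob A"
  shows "mass (lower t) \<le> mass A"
  using mass_le_upper[of t "space \<mu> - A"] assms
  by (simp add: mass_Compl mass_lower prob_compl prob_lower)

text \<open>The slice between the levels \<open>t1\<close> and \<open>t\<close> is as probable as
  \<open>lower t2\<close>, and no set of that probability has less mass than
  \<open>lower t2\<close>.\<close>

lemma mass_lower_superadditive: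
  assumes "0 \<le> t1" "0 \<le> t2"
    and "prob (lower t) = prob (lower t1) + prob (lower t2)"
  shows "mass (lower t1) + mass (lower t2) \<le> mass (lower t)"
proof (cases "t1 \<le> t")
  case True
  then have sub: "lower t1 \<subseteq> lower t" by auto
  have "prob (lower t - lower t1) = prob (lower t2)"
    using assms(3) sub by (subst finite_measure_Diff) auto
  then have "mass (lower t2) \<le> mass (lower t - lower t1)"
    using assms(2) by (intro mass_ge_lower) auto
  moreover have "mass (lower t1 \<union> (lower t - lower t1)) = mass (lower t1) + mass (lower t - lower t1)"
    by (intro mass_Un) auto
  moreover have "lower t1 \<union> (lower t - lower t1) = lower t"
    using sub by auto
  ultimately show ?thesis by simp
next
  case False
  \<comment> \<open>Degenerate case: \<open>t < t1\<close> forces \<open>lower t2\<close> to be a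
    null set, so its mass vanishes by comparison with the empty set.\<close>
  then have "prob (lower t) \<le> prob (lower t1)"
    by (intro finite_measure_mono) auto
  then have "prob (lower t2) \<le> 0"
    using assms(3) by simp
  then have "mass (lower t2) \<le> mass {}"
    using assms(2) by (intro mass_ge_lower) auto
  moreover have "mass (lower t1) \<le> mass (lower t)"
    using assms by (intro mass_ge_lower) auto
  ultimately show ?thesis
    by (simp add: set_lebesgue_integral_def)
qed

text \<open>The two parts overlap in a null set only, so their union is a single competitor of
  \<open>upper t\<close> in the bathtub principle.\<close>

lemma mass_upper_add_lower:
  assumes "0 \<le> t" "prob (upper t) = prob (upper t1) + prob (lower t2)"
  shows "mass (upper t1) + mass (lower t2) \<le> mass (upper t)"
proof -
  have null: "prob (upper t1 \<inter> lower t2) = 0"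
  proof (cases "t2 \<le> t1")
    case True
    then have "upper t1 \<inter> lower t2 = {}" by auto
    then show ?thesis by simp
  next
    case False
    \<comment> \<open>When the levels cross, the parts cover the space, and inclusion-exclusion
      gives the overlap a probability that is at most 0.\<close>
    then have "upper t1 \<union> lower t2 = space \<mu>" by auto
    with measure_Un3[of "upper t1" \<mu> "lower t2"]
    have "prob (upper t1 \<inter> lower t2) = prob (upper t) - 1"
      using assms(2) by (simp add: prob_space fmeasurable_eq_sets)
    then show ?thesis
      using prob_le_1[of "upper t"] measure_nonneg[of \<mu> "upper t1 \<inter> lower t2"] by linarith
  qed
  have "prob (upper t1 \<union> lower t2) \<le> prob (upper t)"
    using measure_Un_le[of "upper t1" \<mu> "lower t2"] assms(2) by simp
  then have "mass (upper t1 \<union> lower t2) \<le> mass (upper t)"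
    using assms(1) by (intro mass_le_upper) auto
  then show ?thesis
    using null by (subst (asm) mass_Un) auto
qed

section \<open>Optimal pairs and the values of the game\<close>

text \<open>The deficit against the threshold pair is \<open>a * p + (b - a) * q\<close>, where
  \<open>p\<close> is the mass left unassigned and \<open>q\<close> is what \<open>B\<close> misses
  of the top part. Both terms are nonnegative. As \<open>a\<close> and \<open>b - a\<close> are
  positive, equality forces \<open>p = q = 0\<close>; this fixes the masses of every optimal
  pair.\<close>

lemma profit_le_threshold:
  assumes "0 < a" "a < b" "0 \<le> t"
    and "A \<in> sets \<mu>" "B \<in> sets \<mu>" "prob (A \<inter> B) = 0" "prob B \<le> prob (upper t)"
  shows "a * mass A + b * mass B \<le> a * mass (lower t) + b * mass (upper t)"
    and "a * mass (lower t) + b * mass (upper t) \<le> a * mass A + b * mass B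
      \<Longrightarrow> mass A = mass (lower t) \<and> mass B = mass (upper t)"
proof -
  define p where "p = mass (space \<mu>) - (mass A + mass B)"
  define q where "q = mass (upper t) - mass B"
  have "mass (A \<union> B) \<le> mass (space \<mu>)"
    using assms(4,5) sets.sets_into_space by (intro mass_mono) auto
  then have p: "0 \<le> p"
    using mass_Un[OF assms(4-6)] by (simp add: p_def)
  have q: "0 \<le> q"
    using mass_le_upper[OF assms(3,5,7)] by (simp add: q_def)
  have diff: "a * mass (lower t) + b * mass (upper t) - (a * mass A + b * mass B)
      = a * p + (b - a) * q"
    by (simp add: mass_lower p_def q_def algebra_simps)
  have ap: "0 \<le> a * p" and bq: "0 \<le> (b - a) * q"
    using p q assms(1,2) by simp_all
  show "a * mass A + b * mass B \<le> a * mass (lower t) + b * mass (upper t)"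
    using ap bq diff by linarith
  assume "a * mass (lower t) + b * mass (upper t) \<le> a * mass A + b * mass B"
  then have "a * p = 0" "(b - a) * q = 0"
    using ap bq diff by linarith+
  then have "p = 0" "q = 0"
    using assms(1,2) by auto
  then show "mass A = mass (lower t) \<and> mass B = mass (upper t)"
    by (simp add: p_def q_def mass_lower)
qed

lemma coalition_utility_scaled:
  assumes "finite J" "J \<noteq> {}"
  shows "coalition_utility (\<lambda>i x. lam i * \<psi> x) J = (\<lambda>x. Max (lam ` J) * \<psi> x)"
proof
  fix x
  have "mono (\<lambda>c. c * \<psi> x)"
    using utility_nonneg by (intro monoI mult_right_mono)
  from mono_Max_commute[OF this, of "lam ` J"]
  show "coalition_utility (\<lambda>i x. lam i * \<psi> x) J x = Max (lam ` J) * \<psi> x"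
    using assms by (simp add: coalition_utility_def image_image)
qed

lemma cp_profit_scaled:
  assumes "finite I" "J \<noteq> {}" "J \<subset> I"
  shows "cp_profit \<mu> I (\<lambda>i x. lam i * \<psi> x) J A B
    = Max (lam ` J) * mass A + Max (lam ` (I - J)) * mass B"
proof -
  have "finite J" "I - J \<noteq> {}"
    using assms finite_subset by auto
  then show ?thesis
    using assms by (simp add: cp_profit_def coalition_utility_scaled)
qed

text \<open>Resolves the definite description: one maximizer gives existence, and uniqueness is
  asked only of the mass of the first component.\<close>

lemma cp_game_eqI:
  assumes "finite I" "J \<noteq> {}" "J \<subset> I"
    and "cp_maximizer \<mu> I (\<lambda>i x. lam i * \<psi> x) M J A B"
    and "\<And>A' B'. cp_maximizer \<mu> I (\<lambda>i x. lam i * \<psi> x) M J A' B' \<Longrightarrow> mass A' = mass A"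
  shows "cp_game \<mu> I (\<lambda>i x. lam i * \<psi> x) M J = Max (lam ` J) * mass A"
proof -
  have "finite J" "J \<noteq> I"
    using assms finite_subset by auto
  then have "cp_game \<mu> I (\<lambda>i x. lam i * \<psi> x) M J
    = (THE v. \<exists>A B. cp_maximizer \<mu> I (\<lambda>i x. lam i * \<psi> x) M J A B
        \<and> v = Max (lam ` J) * mass A)"
    using assms(2) by (simp add: cp_game_def coalition_utility_scaled)
  also have "\<dots> = Max (lam ` J) * mass A"
  proof (rule the_equality)
    show "\<exists>A' B'. cp_maximizer \<mu> I (\<lambda>i x. lam i * \<psi> x) M J A' B'
        \<and> Max (lam ` J) * mass A = Max (lam ` J) * mass A'"
      using assms(4) by blast
  next
    fix v
    assume "\<exists>A' B'. cp_maximizer \<mu> I (\<lambda>i x. lam i * \<psi> x) M J A' B' \<and> v = Max (lam ` J) * mass A'"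
    then obtain A' B' where "cp_maximizer \<mu> I (\<lambda>i x. lam i * \<psi> x) M J A' B'"
        and "v = Max (lam ` J) * mass A'"
      by blast
    then show "v = Max (lam ` J) * mass A"
      using assms(5) by simp
  qed
  finally show ?thesis .
qed

lemma cp_game_lower:
  assumes "finite I" "J \<noteq> {}" "J \<subset> I" "sum M I = 1"
    and lam: "0 < Max (lam ` J)" "Max (lam ` J) < Max (lam ` (I - J))"
    and t: "0 \<le> t" "prob (lower t) = sum M J"
  shows "cp_game \<mu> I (\<lambda>i x. lam i * \<psi> x) M J = Max (lam ` J) * mass (lower t)"
proof (rule cp_game_eqI)
  \<comment> \<open>Since the capacities sum to 1, one level \<open>t\<close> exhausts both of
    them.\<close>
  have up: "prob (upper t) = sum M (I - J)"
    using assms by (simp add: prob_lower sum_diff)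
  note thr = profit_le_threshold[OF lam t(1)]
  have "lower t \<inter> upper t = {}" by auto
  then have feas: "cp_feasible \<mu> I M J (lower t) (upper t)"
    using up t by (simp add: cp_feasible_def)
  then show "cp_maximizer \<mu> I (\<lambda>i x. lam i * \<psi> x) M J (lower t) (upper t)"
    using thr(1) up assms(1-3)
    by (auto simp: cp_maximizer_def cp_profit_scaled cp_feasible_def)
  fix A B
  assume "cp_maximizer \<mu> I (\<lambda>i x. lam i * \<psi> x) M J A B"
  then show "mass A = mass (lower t)"
    using thr(2)[of A B] up assms(1-3) feas
    by (auto simp: cp_maximizer_def cp_profit_scaled cp_feasible_def)
qed (use assms in auto)

text \<open>Mirror image of \<open>cp_game_lower\<close>: now \<open>J\<close> has the larger
  factor, so \<open>profit_le_threshold\<close> is applied with the two components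
  exchanged.\<close>

lemma cp_game_upper:
  assumes "finite I" "J \<noteq> {}" "J \<subset> I" "sum M I = 1"
    and lam: "0 < Max (lam ` (I - J))" "Max (lam ` (I - J)) < Max (lam ` J)"
    and t: "0 \<le> t" "prob (upper t) = sum M J"
  shows "cp_game \<mu> I (\<lambda>i x. lam i * \<psi> x) M J = Max (lam ` J) * mass (upper t)"
proof (rule cp_game_eqI)
  have low: "prob (lower t) = sum M (I - J)"
    using assms by (simp add: prob_lower sum_diff)
  note thr = profit_le_threshold[OF lam t(1)]
  have "upper t \<inter> lower t = {}" by auto
  then have feas: "cp_feasible \<mu> I M J (upper t) (lower t)"
    using low t by (simp add: cp_feasible_def)
  then show "cp_maximizer \<mu> I (\<lambda>i x. lam i * \<psi> x) M J (upper t) (lower t)"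
    using thr(1) t assms(1-3)
    by (auto simp: cp_maximizer_def cp_profit_scaled cp_feasible_def Int_commute add.commute)
  fix A B
  assume "cp_maximizer \<mu> I (\<lambda>i x. lam i * \<psi> x) M J A B"
  then show "mass A = mass (upper t)"
    using thr(2)[of B A] t assms(1-3) feas
    by (auto simp: cp_maximizer_def cp_profit_scaled cp_feasible_def Int_commute add.commute)
qed (use assms in auto)

text \<open>Puts the separately defined value of the grand coalition into the form shared by all
  coalitions with the larger factor.\<close>

lemma cp_game_grand:
  assumes "finite I" "I \<noteq> {}" "prob (upper t) = 1" "0 \<le> t"
  shows "cp_game \<mu> I (\<lambda>i x. lam i * \<psi> x) M I = Max (lam ` I) * mass (upper t)"
proof -
  have "mass (space \<mu>) \<le> mass (upper t)"
    using assms by (intro mass_le_upper) (auto simp: prob_space)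
  moreover have "mass (upper t) \<le> mass (space \<mu>)"
    by (intro mass_mono) auto
  ultimately show ?thesis
    using assms by (simp add: cp_game_def coalition_utility_scaled mass_space)
qed

end

section \<open>The game with increasing factors\<close>

locale scaled_cp_game = atomless_utility +
  fixes lam M :: "nat \<Rightarrow> real" and N :: nat
  assumes lam_pos: "i \<in> {1..N} \<Longrightarrow> 0 < lam i"
    and lam_strict_mono: "strict_mono_on {1..N} lam"
    and capacity_pos: "i \<in> {1..N} \<Longrightarrow> 0 < M i"
    and sum_capacity: "sum M {1..N} = 1"
begin

abbreviation \<nu> :: "nat set \<Rightarrow> real" where
  "\<nu> \<equiv> cp_game \<mu> {1..N} (\<lambda>i x. lam i * \<psi> x) M"

lemma finite_coalition: "J \<subseteq> {1..N} \<Longrightarrow> finite J"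
  by (rule finite_subset) auto

lemma Max_lam_pos:
  assumes "J \<subseteq> {1..N}" "J \<noteq> {}"
  shows "0 < Max (lam ` J)"
proof -
  obtain i where "i \<in> J"
    using assms(2) by auto
  then have "i \<in> {1..N}" "lam i \<le> Max (lam ` J)"
    using assms(1) finite_coalition by auto
  then have "0 < lam i" "lam i \<le> Max (lam ` J)"
    using lam_pos by blast+
  then show ?thesis by simp
qed

lemma Max_lam_mono:
  assumes "J \<subseteq> K" "K \<subseteq> {1..N}" "J \<noteq> {}"
  shows "Max (lam ` J) \<le> Max (lam ` K)"
  using assms finite_coalition[OF assms(2)] by (intro Max_mono) auto

text \<open>Agent \<open>N\<close> has the largest factor, so membership of \<open>N\<close> decides
  which side gets the top part. Strictness is what makes the optimal masses unique.\<close>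

lemma Max_lam_less:
  assumes "J \<subseteq> {1..N}" "K \<subseteq> {1..N}" "J \<noteq> {}" "N \<notin> J" "N \<in> K"
  shows "Max (lam ` J) < Max (lam ` K)"
proof -
  have "lam i < lam N" if "i \<in> J" for i
  proof (rule strict_mono_onD[OF lam_strict_mono])
    show "i \<in> {1..N}" "N \<in> {1..N}" "i < N"
      using that assms by (auto simp: order.strict_iff_order)
  qed
  then have "Max (lam ` J) < lam N"
    using assms finite_coalition by (subst Max_less_iff) auto
  also have "lam N \<le> Max (lam ` K)"
    using assms finite_coalition by (intro Max_ge) auto
  finally show ?thesis .
qed

lemma sum_capacity_pos:
  assumes "J \<subseteq> {1..N}" "J \<noteq> {}"
  shows "0 < sum M J"
  using assms finite_coalition capacity_pos by (intro sum_pos) auto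

lemma sum_capacity_less_1:
  assumes "J \<subset> {1..N}"
  shows "sum M J < 1"
  using sum_capacity_pos[of "{1..N} - J"] assms sum_capacity by (auto simp: sum_diff)

lemma game_lower:
  assumes "J \<subseteq> {1..N}" "J \<noteq> {}" "N \<notin> J"
  obtains t where "0 \<le> t" "prob (lower t) = sum M J" "\<nu> J = Max (lam ` J) * mass (lower t)"
proof -
  have sub: "J \<subset> {1..N}"
    using assms by auto
  then have "sum M J < 1"
    by (rule sum_capacity_less_1)
  with sum_capacity_pos[OF assms(1,2)] obtain t where t: "0 \<le> t" "prob (lower t) = sum M J"
    using ex_lower_prob[of "sum M J"] by auto
  moreover have "\<nu> J = Max (lam ` J) * mass (lower t)"
    using assms sub t Max_lam_pos sum_capacity
    by (intro cp_game_lower) (auto intro!: Max_lam_less)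
  ultimately show ?thesis by (rule that)
qed

lemma game_upper:
  assumes "J \<subseteq> {1..N}" "N \<in> J"
  obtains t where "0 \<le> t" "prob (upper t) = sum M J" "\<nu> J = Max (lam ` J) * mass (upper t)"
proof (cases "J = {1..N}")
  case True
  \<comment> \<open>The grand coalition takes level 0, since \<open>\<psi>\<close> is positive
    almost everywhere.\<close>
  have "prob (upper 0) = 1"
    using prob_lower[of 0] prob_lower_0 by simp
  then show ?thesis
    using that[of 0] assms True sum_capacity cp_game_grand[of "{1..N}" 0] by auto
next
  case False
  then have sub: "J \<subset> {1..N}"
    using assms by auto
  then have "sum M J < 1" "0 < sum M J"
    using sum_capacity_less_1 sum_capacity_pos assms by auto
  \<comment> \<open>The level is found from below; positivity of \<open>sum M J\<close> keeps the
    target under 1.\<close>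
  then obtain t where t: "0 \<le> t" "prob (lower t) = 1 - sum M J"
    using ex_lower_prob[of "1 - sum M J"] by auto
  then have up: "prob (upper t) = sum M J"
    by (simp add: prob_lower)
  moreover have "\<nu> J = Max (lam ` J) * mass (upper t)"
  proof (rule cp_game_upper)
    show "0 < Max (lam ` ({1..N} - J))"
      using sub by (intro Max_lam_pos) auto
    show "Max (lam ` ({1..N} - J)) < Max (lam ` J)"
      using sub assms by (intro Max_lam_less) auto
  qed (use assms sub t up sum_capacity in auto)
  ultimately show ?thesis
    using t(1) by (intro that)
qed

section \<open>Superadditivity\<close>

lemma game_superadditive_lower:
  assumes "J1 \<subseteq> {1..N}" "J2 \<subseteq> {1..N}" "J1 \<inter> J2 = {}" "J1 \<noteq> {}" "J2 \<noteq> {}" "N \<notin> J1 \<union> J2"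
  shows "\<nu> J1 + \<nu> J2 \<le> \<nu> (J1 \<union> J2)"
proof -
  obtain t1 where t1: "0 \<le> t1" "prob (lower t1) = sum M J1" "\<nu> J1 = Max (lam ` J1) * mass (lower t1)"
    using game_lower[of J1] assms by auto
  obtain t2 where t2: "0 \<le> t2" "prob (lower t2) = sum M J2" "\<nu> J2 = Max (lam ` J2) * mass (lower t2)"
    using game_lower[of J2] assms by auto
  obtain t where t: "0 \<le> t" "prob (lower t) = sum M (J1 \<union> J2)"
      "\<nu> (J1 \<union> J2) = Max (lam ` (J1 \<union> J2)) * mass (lower t)"
    using game_lower[of "J1 \<union> J2"] assms by auto
  let ?b = "Max (lam ` (J1 \<union> J2))"
  have b: "0 < ?b"
    using assms by (intro Max_lam_pos) auto
  \<comment> \<open>Raising both factors to that of the union reduces the claim to a comparison of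
    masses.\<close>
  have "\<nu> J1 + \<nu> J2 \<le> ?b * mass (lower t1) + ?b * mass (lower t2)"
    unfolding t1 t2 using assms
    by (intro add_mono mult_right_mono Max_lam_mono mass_nonneg) auto
  also have "\<dots> = ?b * (mass (lower t1) + mass (lower t2))"
    by (simp add: distrib_left)
  also have "\<dots> \<le> ?b * mass (lower t)"
    using b t1 t2 t assms finite_coalition
    by (intro mult_left_mono mass_lower_superadditive) (auto simp: sum.union_disjoint)
  finally show ?thesis
    using t by simp
qed

text \<open>Here \<open>J1\<close> holds a top part and \<open>J2\<close> a bottom part, while the
  union, which contains \<open>N\<close>, again holds a top part.\<close>

lemma game_superadditive_upper:
  assumes "J1 \<subseteq> {1..N}" "J2 \<subseteq> {1..N}" "J1 \<inter> J2 = {}" "N \<in> J1" "J2 \<noteq> {}"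
  shows "\<nu> J1 + \<nu> J2 \<le> \<nu> (J1 \<union> J2)"
proof -
  obtain t1 where t1: "0 \<le> t1" "prob (upper t1) = sum M J1" "\<nu> J1 = Max (lam ` J1) * mass (upper t1)"
    using game_upper[of J1] assms by auto
  have "N \<notin> J2"
    using assms by auto
  then obtain t2 where t2: "0 \<le> t2" "prob (lower t2) = sum M J2" "\<nu> J2 = Max (lam ` J2) * mass (lower t2)"
    using game_lower[of J2] assms by auto
  obtain t where t: "0 \<le> t" "prob (upper t) = sum M (J1 \<union> J2)"
      "\<nu> (J1 \<union> J2) = Max (lam ` (J1 \<union> J2)) * mass (upper t)"
    using game_upper[of "J1 \<union> J2"] assms by auto
  let ?b = "Max (lam ` (J1 \<union> J2))"
  have b: "0 < ?b"
    using assms by (intro Max_lam_pos) auto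
  have "\<nu> J1 + \<nu> J2 \<le> ?b * mass (upper t1) + ?b * mass (lower t2)"
    unfolding t1 t2 using assms
    by (intro add_mono mult_right_mono Max_lam_mono mass_nonneg) auto
  also have "\<dots> = ?b * (mass (upper t1) + mass (lower t2))"
    by (simp add: distrib_left)
  also have "\<dots> \<le> ?b * mass (upper t)"
    using b t1 t2 t assms finite_coalition
    by (intro mult_left_mono mass_upper_add_lower) (auto simp: sum.union_disjoint)
  finally show ?thesis
    using t by simp
qed

lemma superadditive_cp_game: "superadditive_game {1..N} \<nu>"
  unfolding superadditive_game_def
proof (intro allI impI)
  fix J1 J2 assume J: "J1 \<subseteq> {1..N}" "J2 \<subseteq> {1..N}" "J1 \<inter> J2 = {}"
  consider "J1 = {}" | "J2 = {}" | "J1 \<noteq> {}" "J2 \<noteq> {}" "N \<in> J1" | "J1 \<noteq> {}" "J2 \<noteq> {}" "N \<in> J2"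
    | "J1 \<noteq> {}" "J2 \<noteq> {}" "N \<notin> J1 \<union> J2"
    by auto
  then show "\<nu> J1 + \<nu> J2 \<le> \<nu> (J1 \<union> J2)"
  proof cases
    case 3
    then show ?thesis using J by (intro game_superadditive_upper)
  next
    case 4
    then have "\<nu> J2 + \<nu> J1 \<le> \<nu> (J2 \<union> J1)"
      using J by (intro game_superadditive_upper) auto
    then show ?thesis by (simp add: add.commute Un_commute)
  next
    case 5
    then show ?thesis using J by (intro game_superadditive_lower)
  qed simp_all
qed

end

section \<open>From continuous utilities on a compact space to the game\<close>

theorem proposition4p4:
  fixes \<mu> :: "'a::t2_space measure"
    and \<psi> :: "'a \<Rightarrow> real"
    and lam M :: "nat \<Rightarrow> real"
    and N :: nat
  assumes "compact (UNIV :: 'a set)"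
    and "prob_space \<mu>" and "sets \<mu> = sets borel"
    and "continuous_on UNIV \<psi>" and "\<And>x. 0 \<le> \<psi> x"
    and "\<And>r. measure \<mu> {x. \<psi> x = r} = 0"
    and "\<And>i. i \<in> {1..N} \<Longrightarrow> 0 < lam i" and "strict_mono_on {1..N} lam"
    and "\<And>i. i \<in> {1..N} \<Longrightarrow> 0 < M i"
    and "(\<Sum>i\<in>{1..N}. M i) = measure \<mu> UNIV"
  shows "superadditive_game {1..N} (cp_game \<mu> {1..N} (\<lambda>i x. lam i * \<psi> x) M)"
proof -
  interpret prob_space \<mu> by fact
  have space: "space \<mu> = UNIV"
    using sets_eq_imp_space_eq[OF assms(3)] by simp
  have meas: "\<psi> \<in> borel_measurable \<mu>"
    using borel_measurable_continuous_onI[OF assms(4)]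
    by (simp add: measurable_cong_sets[OF assms(3) refl])
  \<comment> \<open>A continuous function on a compact space is bounded, hence integrable against a
    probability measure.\<close>
  have "bounded (range \<psi>)"
    using assms(1,4) by (intro compact_imp_bounded compact_continuous_image)
  then obtain K where "norm (\<psi> x) \<le> K" for x
    unfolding bounded_iff by auto
  with meas have int: "integrable \<mu> \<psi>"
    by (intro integrable_const_bound[of _ K]) auto
  interpret scaled_cp_game \<mu> \<psi> lam M N
    using assms int prob_space by unfold_locales (auto simp: space)
  show ?thesis by (rule superadditive_cp_game)
qed

end
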